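(* Let $A=\begin{pmatrix} a & b\\ c& d\end{pmatrix}$ be a $2\times 2$ $q$-quantum matrix, let $\delta=ad-qbc$, put $\tau=q^{1/2}a+q^{-1/2}d$ and $\tau'=q^{-1/2}a+q^{1/2}d$, and write $A^n=\begin{pmatrix} a_n & b_n\\ c_n & d_n\end{pmatrix}$. Then for every positive integer $n$, \begin{align*} a_{n}&=q^{-\frac{n-1}{2}}a f_{n-1}(\tau)-q^{-\frac{n}{2}}\delta f_{n-2}(\tau)=q^{\frac{n-1}{2}}f_{n-1}(\tau')a-q^{\frac{n}{2}}\delta f_{n-2}(\tau'),\\ b_{n}&=q^{\frac{n-1}{2}}b f_{n-1}(\tau)=q^{\frac{n-1}{2}}f_{n-1}(\tau')b,\\ c_{n}&=q^{-\frac{n-1}{2}}c f_{n-1}(\tau)=q^{-\frac{n-1}{2}}f_{n-1}(\tau')c,\\ d_{n}&=q^{\frac{n-1}{2}}d f_{n-1}(\tau)-q^{\frac{n}{2}}\delta f_{n-2}(\tau)=q^{-\frac{n-1}{2}}f_{n-1}(\tau')d-q^{-\frac{n}{2}}\delta f_{n-2}(\tau'). \end{align*}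
   Context: Let $k$ be a fixed base field and let $q$ be a central indeterminate, with a central invertible square root $q^{1/2}$ (inverse $q^{-1/2}$) adjoined. A $2\times 2$ ($q$-)quantum matrix is a matrix $A=\begin{pmatrix} a & b\\ c& d\end{pmatrix}$ whose entries satisfy the relations $$ab=qba,\quad ac=qca,\quad ad-da=(q-q^{-1})bc,\quad bc=cb,\quad bd=qdb,\quad cd=qdc.$$ The ambient (noncommutative) algebra is $\mathcal{A}_q(Mat(2))$, the algebra generated by $a,b,c,d$ and $q$ with these relations (with $q^{\pm 1/2}$ adjoined). The quantum determinant is $\delta=ad-qbc=da-q^{-1}bc$, which is a central element of this algebra. For an element $x$ of the algebra, set $f_{-1}(x)=0$ and, for $n\ge 0$, $$f_{n}(x)=f_n(x,\delta)=\sum_{l=0}^{\lfloor n/2\rfloor}(-1)^{l}\binom{n-l}{l}x^{n-2l}\delta^{l}.$$ *)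

theory Defs
  imports "Jordan_Normal_Form.Matrix"
begin

text \<open>An associative unital algebra over a field; HOL-Algebra's locale \<open>algebra\<close> covers
  commutative algebras only.\<close>

locale k_algebra = vector_space scale
  for scale :: "'k::field \<Rightarrow> 'r::ring_1 \<Rightarrow> 'r" +
  assumes scale_mult_left: "scale k x * y = scale k (x * y)"
    and scale_mult_right: "x * scale k y = scale k (x * y)"

text \<open>A \<open>k\<close>-algebra with adjoined central \<open>s\<close> (for \<open>q^(1/2)\<close>) and its inverse \<open>t\<close> (for
  \<open>q^(-1/2)\<close>), that is, an algebra over the Laurent polynomials in the indeterminate \<open>q^(1/2)\<close>.
  Thus \<open>q\<close> is \<open>s\<^sup>2\<close>, and \<open>q^(-1)\<close> is \<open>t\<^sup>2\<close>.\<close>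

locale q_algebra = k_algebra scale
  for scale :: "'k::field \<Rightarrow> 'r::ring_1 \<Rightarrow> 'r" +
  fixes s t :: 'r
  assumes s_central: "s * x = x * s"
    and s_t: "s * t = 1"
    and t_s: "t * s = 1"

text \<open>The argument \<open>q'\<close> stands for the inverse of \<open>q\<close>, as rings carry no inverse operation.\<close>

definition quantum_matrix :: "'r::ring_1 \<Rightarrow> 'r \<Rightarrow> 'r mat \<Rightarrow> bool" where
  "quantum_matrix q q' A \<longleftrightarrow> A \<in> carrier_mat 2 2 \<and>
    (let a = A $$ (0,0); b = A $$ (0,1); c = A $$ (1,0); d = A $$ (1,1) in
      a * b = q * b * a \<and>
      a * c = q * c * a \<and>
      a * d - d * a = (q - q') * b * c \<and>
      b * c = c * b \<and>
      b * d = q * d * b \<and>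
      c * d = q * d * c)"

text \<open>The index is an integer because \<open>f_poly\<close> is needed at \<open>-1\<close>, where it vanishes; the other
  negative indices never occur.\<close>

definition f_poly :: "int \<Rightarrow> 'r::ring_1 \<Rightarrow> 'r \<Rightarrow> 'r" where
  "f_poly m x \<delta> = (if m < 0 then 0 else
     (\<Sum>l = 0..nat m div 2.
       (- 1) ^ l * of_nat ((nat m - l) choose l) * x ^ (nat m - 2 * l) * \<delta> ^ l))"


section \<open>The algebra of quantum 2 by 2 matrices\<close>

text \<open>The universal case of the above: the \<open>k\<close>-algebra presented by generators \<open>a, b, c, d\<close> and a
  central invertible \<open>q^(1/2)\<close>, subject to the relations of a quantum matrix. Its elements are
  formal noncommutative polynomials modulo the least congruence containing the laws of a
  \<open>k\<close>-algebra and the defining relations.\<close>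

datatype 'k qterm =
    Sc 'k | GA | GB | GC | GD | GS | GT
  | Plus "'k qterm" "'k qterm" | Times "'k qterm" "'k qterm"

inductive qcong :: "'k::field qterm \<Rightarrow> 'k qterm \<Rightarrow> bool" where
  qc_refl: "qcong x x"
| qc_sym: "qcong x y \<Longrightarrow> qcong y x"
| qc_trans: "qcong x y \<Longrightarrow> qcong y z \<Longrightarrow> qcong x z"
| qc_plus: "qcong x x' \<Longrightarrow> qcong y y' \<Longrightarrow> qcong (Plus x y) (Plus x' y')"
| qc_times: "qcong x x' \<Longrightarrow> qcong y y' \<Longrightarrow> qcong (Times x y) (Times x' y')"
| qc_plus_assoc: "qcong (Plus (Plus x y) z) (Plus x (Plus y z))"
| qc_plus_comm: "qcong (Plus x y) (Plus y x)"
| qc_plus_zero: "qcong (Plus (Sc 0) x) x"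
| qc_plus_neg: "qcong (Plus (Times (Sc (- 1)) x) x) (Sc 0)"
| qc_times_assoc: "qcong (Times (Times x y) z) (Times x (Times y z))"
| qc_times_one: "qcong (Times (Sc 1) x) x"
| qc_distrib_left: "qcong (Times x (Plus y z)) (Plus (Times x y) (Times x z))"
| qc_distrib_right: "qcong (Times (Plus x y) z) (Plus (Times x z) (Times y z))"
| qc_Sc_plus: "qcong (Plus (Sc k) (Sc m)) (Sc (k + m))"
| qc_Sc_times: "qcong (Times (Sc k) (Sc m)) (Sc (k * m))"
| qc_Sc_central: "qcong (Times (Sc k) x) (Times x (Sc k))"
| qc_s_central: "qcong (Times GS x) (Times x GS)"
| qc_s_t: "qcong (Times GS GT) (Sc 1)"
| qc_t_s: "qcong (Times GT GS) (Sc 1)"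
| qc_rel_ab: "qcong (Times GA GB) (Times (Times (Times GS GS) GB) GA)"
| qc_rel_ac: "qcong (Times GA GC) (Times (Times (Times GS GS) GC) GA)"
| qc_rel_ad: "qcong (Plus (Times GA GD) (Times (Sc (- 1)) (Times GD GA)))
    (Times (Times (Plus (Times GS GS) (Times (Sc (- 1)) (Times GT GT))) GB) GC)"
| qc_rel_bc: "qcong (Times GB GC) (Times GC GB)"
| qc_rel_bd: "qcong (Times GB GD) (Times (Times (Times GS GS) GD) GB)"
| qc_rel_cd: "qcong (Times GC GD) (Times (Times (Times GS GS) GD) GC)"

text \<open>Sending all generators to 1 respects the relations, so the quotient is not the zero ring.\<close>

primrec augment :: "'k::field qterm \<Rightarrow> 'k" where
  "augment (Sc k) = k"
| "augment GA = 1"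
| "augment GB = 1"
| "augment GC = 1"
| "augment GD = 1"
| "augment GS = 1"
| "augment GT = 1"
| "augment (Plus x y) = augment x + augment y"
| "augment (Times x y) = augment x * augment y"

lemma augment_qcong: "qcong x y \<Longrightarrow> augment x = augment y"
  by (induction rule: qcong.induct) (simp_all add: algebra_simps)

quotient_type (overloaded) 'k quantum_Mat2 = "'k::field qterm" / qcong
proof (rule equivpI)
  show "reflp qcong" by (simp add: reflp_def qc_refl)
  show "symp qcong" by (auto simp: symp_def intro: qc_sym)
  show "transp qcong" by (auto simp: transp_def intro: qc_trans)
qed

instantiation quantum_Mat2 :: (field) ring_1
begin

lift_definition zero_quantum_Mat2 :: "'a quantum_Mat2" is "Sc 0" .
lift_definition one_quantum_Mat2 :: "'a quantum_Mat2" is "Sc 1" .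
lift_definition plus_quantum_Mat2 :: "'a quantum_Mat2 \<Rightarrow> 'a quantum_Mat2 \<Rightarrow> 'a quantum_Mat2"
  is Plus by (rule qc_plus)
lift_definition times_quantum_Mat2 :: "'a quantum_Mat2 \<Rightarrow> 'a quantum_Mat2 \<Rightarrow> 'a quantum_Mat2"
  is Times by (rule qc_times)
lift_definition uminus_quantum_Mat2 :: "'a quantum_Mat2 \<Rightarrow> 'a quantum_Mat2"
  is "Times (Sc (- 1))" by (rule qc_times[OF qc_refl])
lift_definition minus_quantum_Mat2 :: "'a quantum_Mat2 \<Rightarrow> 'a quantum_Mat2 \<Rightarrow> 'a quantum_Mat2"
  is "\<lambda>x y. Plus x (Times (Sc (- 1)) y)"
  by (intro qc_plus qc_times qc_refl)

instance
proof
  fix x y z :: "'a quantum_Mat2"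
  show "x + y + z = x + (y + z)" by transfer (rule qc_plus_assoc)
  show "x + y = y + x" by transfer (rule qc_plus_comm)
  show "0 + x = x" by transfer (rule qc_plus_zero)
  show "- x + x = 0" by transfer (rule qc_plus_neg)
  show "x - y = x + - y" by transfer (rule qc_refl)
  show "x * y * z = x * (y * z)" by transfer (rule qc_times_assoc)
  show "1 * x = x" by transfer (rule qc_times_one)
  show "x * 1 = x"
    by transfer (rule qc_trans[OF qc_sym[OF qc_Sc_central] qc_times_one])
  show "(x + y) * z = x * z + y * z" by transfer (rule qc_distrib_right)
  show "x * (y + z) = x * y + x * z" by transfer (rule qc_distrib_left)
  show "(0 :: 'a quantum_Mat2) \<noteq> 1" by transfer (auto dest: augment_qcong)
qed

end

lift_definition qa :: "'k::field quantum_Mat2" is GA .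
lift_definition qb :: "'k::field quantum_Mat2" is GB .
lift_definition qc :: "'k::field quantum_Mat2" is GC .
lift_definition qd :: "'k::field quantum_Mat2" is GD .
lift_definition qs :: "'k::field quantum_Mat2" is GS .
lift_definition qt :: "'k::field quantum_Mat2" is GT .
lift_definition qsc :: "'k::field \<Rightarrow> 'k quantum_Mat2" is Sc .

lemma qsc_hom:
  "qsc (k + m) = qsc k + qsc m" "qsc (k * m) = qsc k * qsc m" "qsc 1 = 1" "qsc k * x = x * qsc k"
  by (transfer, rule qc_sym, rule qc_Sc_plus)
     (transfer, rule qc_sym, rule qc_Sc_times,
      transfer, rule qc_refl,
      transfer, rule qc_Sc_central)

lemma q_algebra_quantum_Mat2:
  "q_algebra (\<lambda>k x. qsc k * x) qs (qt :: 'k::field quantum_Mat2)"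
proof
  fix x :: "'k quantum_Mat2"
  show "qs * x = x * qs" by transfer (rule qc_s_central)
  show "qs * qt = (1 :: 'k quantum_Mat2)" by transfer (rule qc_s_t)
  show "qt * qs = (1 :: 'k quantum_Mat2)" by transfer (rule qc_t_s)
  fix k m :: 'k and y :: "'k quantum_Mat2"
  show "qsc k * (x + y) = qsc k * x + qsc k * y" by (rule distrib_left)
  show "qsc (k + m) * x = qsc k * x + qsc m * x" by (simp only: qsc_hom(1) distrib_right)
  show "qsc k * (qsc m * x) = qsc (k * m) * x" by (simp only: qsc_hom(2) mult.assoc)
  show "qsc 1 * x = x" by (simp only: qsc_hom(3) mult_1_left)
  show "qsc k * x * y = qsc k * (x * y)" by (rule mult.assoc)
  have "x * (qsc k * y) = x * qsc k * y" by (rule mult.assoc[symmetric])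
  also have "\<dots> = qsc k * x * y" by (rule arg_cong[OF qsc_hom(4)[symmetric]])
  also have "\<dots> = qsc k * (x * y)" by (rule mult.assoc)
  finally show "x * (qsc k * y) = qsc k * (x * y)" .
qed

lemma mat_of_rows_list_2_entries:
  "mat_of_rows_list 2 [[a, b], [c, d]] $$ (0,0) = a"
  "mat_of_rows_list 2 [[a, b], [c, d]] $$ (0,1) = b"
  "mat_of_rows_list 2 [[a, b], [c, d]] $$ (1,0) = c"
  "mat_of_rows_list 2 [[a, b], [c, d]] $$ (1,1) = d"
  by (simp_all add: mat_of_rows_list_def)

lemma quantum_matrix_generic:
  "quantum_matrix (qs\<^sup>2) (qt\<^sup>2) (mat_of_rows_list 2 [[qa, qb], [qc, qd :: 'k::field quantum_Mat2]])"
proof -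
  have "qa * qb = qs * qs * qb * (qa :: 'k quantum_Mat2)" by transfer (rule qc_rel_ab)
  moreover have "qa * qc = qs * qs * qc * (qa :: 'k quantum_Mat2)" by transfer (rule qc_rel_ac)
  moreover have "qa * qd - qd * qa = (qs * qs - qt * qt) * qb * (qc :: 'k quantum_Mat2)"
    by transfer (rule qc_rel_ad)
  moreover have "qb * qc = qc * (qb :: 'k quantum_Mat2)" by transfer (rule qc_rel_bc)
  moreover have "qb * qd = qs * qs * qd * (qb :: 'k quantum_Mat2)" by transfer (rule qc_rel_bd)
  moreover have "qc * qd = qs * qs * qd * (qc :: 'k quantum_Mat2)" by transfer (rule qc_rel_cd)
  moreover have "mat_of_rows_list 2 [[qa, qb], [qc, qd :: 'k quantum_Mat2]] \<in> carrier_mat 2 2"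
    by (simp add: mat_of_rows_list_def numeral_2_eq_2)
  ultimately show ?thesis
    unfolding quantum_matrix_def Let_def power2_eq_square
    by (simp only: mat_of_rows_list_2_entries simp_thms)
qed

end

theory Submission
  imports Defs
begin

text \<open>
  Let \<open>E\<close> be the diagonal matrix with entries \<open>q^(-1/2), q^(1/2)\<close>. Its entries are central, and
  expanding the four entries of \<open>A\<^sup>2\<close> with the defining relations gives two quantum versions of the
  Cayley-Hamilton identity:
  \<open>A\<^sup>2 = A E \<tau> - E\<^sup>2 \<delta>\<close> and \<open>A\<^sup>2 = \<tau>' E\<inverse> A - E\<inverse>\<^sup>2 \<delta>\<close>
  (\<open>square_entries_right\<close>, \<open>square_entries_left\<close>). In general \<open>\<tau>\<close> and \<open>\<tau>'\<close> do not commute with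
  the entries of \<open>A\<close>, so it matters that \<open>\<tau>\<close> stands on the right and \<open>\<tau>'\<close> on the left.

  Multiplying the first identity by \<open>A\<^sup>n\<close> from the left, and the second from the right, turns them
  into three-term recurrences for each single entry \<open>x\<^sub>n\<close> of \<open>A\<^sup>n\<close>:
  \<open>x\<^sub>n\<^sub>+\<^sub>2 = e x\<^sub>n\<^sub>+\<^sub>1 \<tau> - e\<^sup>2 x\<^sub>n \<delta>\<close>, where the central element \<open>e\<close> is an entry of \<open>E\<close> that depends only on
  the column, and \<open>x\<^sub>n\<^sub>+\<^sub>2 = e \<tau>' x\<^sub>n\<^sub>+\<^sub>1 - e\<^sup>2 \<delta> x\<^sub>n\<close>, where \<open>e\<close> is an entry of \<open>E\<inverse>\<close> that depends only on the row.

  The \<open>f\<^sub>n\<close> are Chebyshev-like polynomials: Pascal's rule gives \<open>f\<^sub>n\<^sub>+\<^sub>1 = x f\<^sub>n - \<delta> f\<^sub>n\<^sub>-\<^sub>1\<close> as soon as \<open>x\<close>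
  commutes with \<open>\<delta>\<close>. So they solve both recurrences, with the entries of \<open>1\<close> and of \<open>A\<close> as initial
  values. The term containing \<open>f\<^sub>n\<^sub>-\<^sub>2\<close> carries the entry of the identity matrix as a factor, which is
  why it appears on the diagonal only.
\<close>

section \<open>The polynomials f\<close>

lemma f_poly_neg_one [simp]: "f_poly (- 1) x \<delta> = 0"
  by (simp add: f_poly_def)

lemma f_poly_0 [simp]: "f_poly 0 x \<delta> = 1"
  by (simp add: f_poly_def)

text \<open>The binomial coefficient vanishes beyond the upper summation bound in the definition, so any
  larger bound gives the same value. This lets three consecutive \<open>f\<^sub>n\<close> be summed over matching ranges,
  without regard to the parity of \<open>n\<close>.\<close>

lemma f_poly_eq_sum_atMost:
  fixes x \<delta> :: "'r::ring_1"
  assumes "n \<le> N"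
  shows "f_poly (int n) x \<delta> =
    (\<Sum>l\<le>N. of_int ((- 1) ^ l * int ((n - l) choose l)) * (x ^ (n - 2 * l) * \<delta> ^ l))"
proof -
  have "f_poly (int n) x \<delta> =
      (\<Sum>l\<le>n div 2. of_int ((- 1) ^ l * int ((n - l) choose l)) * (x ^ (n - 2 * l) * \<delta> ^ l))"
    by (simp add: f_poly_def atMost_atLeast0 mult.assoc)
  also have "\<dots> = (\<Sum>l\<le>N. of_int ((- 1) ^ l * int ((n - l) choose l)) * (x ^ (n - 2 * l) * \<delta> ^ l))"
  proof (rule sum.mono_neutral_left)
    have "n - l < l" if "\<not> l \<le> n div 2" for l
      using that by linarith
    then show "\<forall>l \<in> {..N} - {..n div 2}.
        of_int ((- 1) ^ l * int (n - l choose l)) * (x ^ (n - 2 * l) * \<delta> ^ l) = 0"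
      by (auto simp: binomial_eq_0)
  qed (use assms in auto)
  finally show ?thesis .
qed

text \<open>Pascal's rule, arranged so that it holds for all \<open>l\<close>: when \<open>l\<close> exceeds \<open>n\<close>, every truncated
  difference is 0 and every coefficient vanishes.\<close>

lemma signed_binomial_recurrence:
  "(- 1) ^ Suc l * int ((Suc (Suc n) - Suc l) choose Suc l) =
   (- 1) ^ Suc l * int ((Suc n - Suc l) choose Suc l) - (- 1) ^ l * int ((n - l) choose l)"
proof (cases "l \<le> n")
  case True
  then have "Suc (Suc n) - Suc l = Suc (n - l)" by simp
  then show ?thesis by (simp add: algebra_simps)
qed auto

lemma f_poly_recurrence_left:
  fixes x \<delta> :: "'r::ring_1"
  assumes comm: "\<delta> * x = x * \<delta>"
  shows "f_poly (int n + 1) x \<delta> = x * f_poly (int n) x \<delta> - \<delta> * f_poly (int n - 1) x \<delta>"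
proof (cases n)
  case 0
  then show ?thesis by (simp add: f_poly_def)
next
  case (Suc m)
  define k where "k n l = (- 1) ^ l * int ((n - l) choose l)" for n l :: nat
  \<comment> \<open>The monomial paired with index \<open>l\<close> in \<open>f\<close> at \<open>m + 2\<close>. Multiplication by \<open>x\<close> turns the
    \<open>l\<close>-th monomial at \<open>m + 1\<close> into it, and multiplication by \<open>\<delta>\<close> the \<open>(l - 1)\<close>-st one at \<open>m\<close>.\<close>
  define M where "M l = x ^ (Suc (Suc m) - 2 * l) * \<delta> ^ l" for l
  have k_zero: "k n l = 0" if "n < 2 * l" for n l
    using that by (auto simp: k_def)
  have k_rec: "k (Suc (Suc m)) (Suc l) = k (Suc m) (Suc l) - k m l" for l
    unfolding k_def by (rule signed_binomial_recurrence)
  have pull: "y * (of_int i * z) = of_int i * (y * z)" for y z :: 'r and i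
    by (metis mult.assoc mult_of_int_commute)
  have \<delta>_power: "\<delta> * (x ^ i * y) = x ^ i * (\<delta> * y)" for i y
    using power_commuting_commutes[OF comm[symmetric], of i] by (metis mult.assoc)
  have x_term: "x * (of_int (k (Suc m) l) * (x ^ (Suc m - 2 * l) * \<delta> ^ l)) = of_int (k (Suc m) l) * M l" for l
  proof (cases "2 * l \<le> Suc m")
    case True
    then have "Suc (Suc m) - 2 * l = Suc (Suc m - 2 * l)" by simp
    then show ?thesis by (simp add: pull M_def mult.assoc)
    \<comment> \<open>The truncated exponents do not match beyond this range, but the coefficient is then 0.\<close>
  qed (simp add: k_zero)
  have \<delta>_term: "\<delta> * (of_int (k m l) * (x ^ (m - 2 * l) * \<delta> ^ l)) = of_int (k m l) * M (Suc l)" for l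
    by (simp add: pull M_def \<delta>_power)
  have "f_poly (int (Suc (Suc m))) x \<delta> = (\<Sum>l\<le>Suc (Suc m). of_int (k (Suc (Suc m)) l) * M l)"
    by (simp only: f_poly_eq_sum_atMost[OF order_refl] k_def M_def)
  also have "\<dots> = M 0 + (\<Sum>l\<le>Suc m. of_int (k (Suc (Suc m)) (Suc l)) * M (Suc l))"
    unfolding sum.atMost_Suc_shift[of _ "Suc m"] by (simp add: k_def)
  also have "\<dots> = (M 0 + (\<Sum>l\<le>Suc m. of_int (k (Suc m) (Suc l)) * M (Suc l))) -
      (\<Sum>l\<le>Suc m. of_int (k m l) * M (Suc l))"
    by (simp only: k_rec of_int_diff left_diff_distrib sum_subtractf add_diff_eq)
  also have "M 0 + (\<Sum>l\<le>Suc m. of_int (k (Suc m) (Suc l)) * M (Suc l)) =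
      (\<Sum>l\<le>Suc (Suc m). of_int (k (Suc m) l) * M l)"
    unfolding sum.atMost_Suc_shift[of _ "Suc m"] by (simp add: k_def)
  also have "\<dots> = x * f_poly (int (Suc m)) x \<delta>"
    by (simp only: f_poly_eq_sum_atMost[of "Suc m" "Suc (Suc m)", OF le_SucI, OF order_refl]
        sum_distrib_left x_term flip: k_def)
  also have "(\<Sum>l\<le>Suc m. of_int (k m l) * M (Suc l)) = \<delta> * f_poly (int m) x \<delta>"
    by (simp only: f_poly_eq_sum_atMost[of m "Suc m", OF le_SucI, OF order_refl]
        sum_distrib_left \<delta>_term flip: k_def)
  finally show ?thesis
    by (simp add: Suc add.commute)
qed

lemma f_poly_commutes:
  fixes x \<delta> y :: "'r::ring_1"
  assumes "y * x = x * y" and "y * \<delta> = \<delta> * y"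
  shows "y * f_poly m x \<delta> = f_poly m x \<delta> * y"
proof (cases "m < 0")
  case False
  then obtain n where m: "m = int n"
    by (metis nonneg_int_cases linorder_not_less)
  have "y * (of_int i * (x ^ j * \<delta> ^ l)) = of_int i * (x ^ j * \<delta> ^ l) * y" for i j l
  proof -
    have "y * x ^ j = x ^ j * y" "y * \<delta> ^ l = \<delta> ^ l * y"
      using assms by (metis power_commuting_commutes)+
    then show ?thesis by (metis mult.assoc mult_of_int_commute)
  qed
  then show ?thesis
    unfolding m f_poly_eq_sum_atMost[OF order_refl] sum_distrib_left sum_distrib_right by (intro sum.cong refl)
qed (simp add: f_poly_def)

lemma f_poly_recurrence_right:
  fixes x \<delta> :: "'r::ring_1"
  assumes comm: "\<delta> * x = x * \<delta>"
  shows "f_poly (int n + 1) x \<delta> = f_poly (int n) x \<delta> * x - f_poly (int n - 1) x \<delta> * \<delta>"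
  using f_poly_recurrence_left[OF comm, of n] f_poly_commutes[of x x \<delta>] f_poly_commutes[of \<delta> x \<delta>]
  by (simp add: comm)


section \<open>Sequences satisfying a twisted second-order recurrence\<close>

text \<open>The powers of \<open>e\<close> absorb the twist, leaving the recurrence of the \<open>f\<^sub>n\<close>. Since
  \<open>\<tau>\<close> and \<open>\<delta>\<close> act from the right, so do the \<open>f\<^sub>n\<close>, and nothing has to be moved past the initial values.\<close>

lemma recurrence_solution_right:
  fixes x :: "nat \<Rightarrow> 'r::ring_1"
  assumes comm: "\<delta> * \<tau> = \<tau> * \<delta>"
    and rec: "\<And>n. x (Suc (Suc n)) = e * x (Suc n) * \<tau> - e\<^sup>2 * x n * \<delta>"
  shows "x (Suc n) = e ^ n * x 1 * f_poly (int n) \<tau> \<delta> - e ^ Suc n * x 0 * \<delta> * f_poly (int n - 1) \<tau> \<delta>"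
proof (induction n rule: induct_nat_012)
  case 0
  show ?case by simp
next
  case 1
  show ?case
    using f_poly_recurrence_left[OF comm, of 0] rec[of 0] by (simp add: power2_eq_square mult.assoc)
next
  case (ge2 n)
  let ?f = "\<lambda>m. f_poly m \<tau> \<delta>"
  have f: "?f (int n + 2) = ?f (int n + 1) * \<tau> - ?f (int n) * \<delta>"
    "?f (int n + 1) = ?f (int n) * \<tau> - ?f (int n - 1) * \<delta>"
    using f_poly_recurrence_right[OF comm, of "Suc n"] f_poly_recurrence_right[OF comm, of n]
    by (simp_all add: add.commute)
  have index: "int (Suc m) = int m + 1" "int m + 1 + 1 = int m + 2"
    "int m + 1 - 1 = int m" "int m + 2 - 1 = int m + 1" for m
    by simp_all
  show ?case
    unfolding rec[of "Suc n"] ge2 index f by (simp add: algebra_simps power2_eq_square)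
qed

lemma recurrence_solution_left:
  fixes x :: "nat \<Rightarrow> 'r::ring_1"
  assumes central: "\<And>y. e * y = y * e"
    and comm: "\<delta> * \<tau> = \<tau> * \<delta>"
    and rec: "\<And>n. x (Suc (Suc n)) = e * \<tau> * x (Suc n) - e\<^sup>2 * \<delta> * x n"
  shows "x (Suc n) = e ^ n * f_poly (int n) \<tau> \<delta> * x 1 - e ^ Suc n * \<delta> * f_poly (int n - 1) \<tau> \<delta> * x 0"
proof (induction n rule: induct_nat_012)
  case 0
  show ?case by simp
next
  case 1
  show ?case
    using f_poly_recurrence_left[OF comm, of 0] rec[of 0] by (simp add: power2_eq_square mult.assoc)
next
  case (ge2 n)
  let ?f = "\<lambda>m. f_poly m \<tau> \<delta>"
  have f: "?f (int n + 2) = \<tau> * ?f (int n + 1) - \<delta> * ?f (int n)"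
    "?f (int n + 1) = \<tau> * ?f (int n) - \<delta> * ?f (int n - 1)"
    using f_poly_recurrence_left[OF comm, of "Suc n"] f_poly_recurrence_left[OF comm, of n]
    by (simp_all add: add.commute)
  have pull: "y * (e * z) = e * (y * z)" "y * (e ^ i * z) = e ^ i * (y * z)" for y z i
    using central[of y] power_commuting_commutes[OF central[of y], of i] by (metis mult.assoc)+
  have \<tau>\<delta>: "\<tau> * (\<delta> * z) = \<delta> * (\<tau> * z)" for z
    by (metis comm mult.assoc)
  have index: "int (Suc m) = int m + 1" "int m + 1 + 1 = int m + 2"
    "int m + 1 - 1 = int m" "int m + 2 - 1 = int m + 1" for m
    by simp_all
  show ?case
    unfolding rec[of "Suc n"] ge2 index f
    by (simp add: ring_distribs power2_eq_square mult.assoc pull[of \<tau>] pull[of \<delta>] \<tau>\<delta>)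
qed


section \<open>Matrices with a twisted Cayley-Hamilton identity\<close>

text \<open>The identity for the square is assumed in a single column only: a column of \<open>A^(n+2) = A^n A\<^sup>2\<close>
  depends on no other column of \<open>A\<^sup>2\<close>. Hence \<open>e\<close> may vary with the column.\<close>

lemma index_pow_mat_right:
  fixes A :: "'r::ring_1 mat"
  assumes A: "A \<in> carrier_mat m m" and i: "i < m" and j: "j < m"
    and central: "\<And>y. e * y = y * e"
    and comm: "\<delta> * \<tau> = \<tau> * \<delta>"
    and sq: "\<And>k. k < m \<Longrightarrow> (A * A) $$ (k, j) = e * A $$ (k, j) * \<tau> - e\<^sup>2 * 1\<^sub>m m $$ (k, j) * \<delta>"
  shows "(A ^\<^sub>m Suc n) $$ (i, j) =
    e ^ n * A $$ (i, j) * f_poly (int n) \<tau> \<delta> - e ^ Suc n * 1\<^sub>m m $$ (i, j) * \<delta> * f_poly (int n - 1) \<tau> \<delta>"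
proof -
  have prod: "(B * C) $$ (i, j) = (\<Sum>k = 0..<m. B $$ (i, k) * C $$ (k, j))"
    if "B \<in> carrier_mat m m" "C \<in> carrier_mat m m" for B C :: "'r mat"
    using that i j by (auto simp: scalar_prod_def)
  have pull: "y * (e * z) = e * (y * z)" for y z
    by (metis central mult.assoc)
  have "(A ^\<^sub>m Suc (Suc n)) $$ (i, j) = e * (A ^\<^sub>m Suc n) $$ (i, j) * \<tau> - e\<^sup>2 * (A ^\<^sub>m n) $$ (i, j) * \<delta>" for n
  proof -
    let ?P = "A ^\<^sub>m n"
    have P: "?P \<in> carrier_mat m m" using A by simp
    have "(A ^\<^sub>m Suc (Suc n)) $$ (i, j) = (\<Sum>k = 0..<m. ?P $$ (i, k) * (A * A) $$ (k, j))"
      using A P by (simp add: assoc_mult_mat[OF P A A] prod del: index_mult_mat)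
    also have "\<dots> = (\<Sum>k = 0..<m. e * (?P $$ (i, k) * A $$ (k, j)) * \<tau> - e\<^sup>2 * (?P $$ (i, k) * 1\<^sub>m m $$ (k, j)) * \<delta>)"
      by (rule sum.cong) (simp_all only: sq atLeastLessThan_iff
        right_diff_distrib power2_eq_square mult.assoc
        pull[of "?P $$ (i, k)" for k])
    also have "\<dots> = e * (?P * A) $$ (i, j) * \<tau> - e\<^sup>2 * (?P * 1\<^sub>m m) $$ (i, j) * \<delta>"
      unfolding prod[OF P A] prod[OF P one_carrier_mat]
      by (simp only: sum_subtractf sum_distrib_left sum_distrib_right)
    finally show ?thesis by (simp add: right_mult_one_mat[OF P])
  qed
  from recurrence_solution_right[where x = "\<lambda>n. (A ^\<^sub>m n) $$ (i, j)", OF comm this, of n]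
  show ?thesis using A by simp
qed

text \<open>The mirror image, with \<open>A^(n+2) = A\<^sup>2 A^n\<close>, works row by row.\<close>

lemma index_pow_mat_left:
  fixes A :: "'r::ring_1 mat"
  assumes A: "A \<in> carrier_mat m m" and i: "i < m" and j: "j < m"
    and central: "\<And>y. e * y = y * e"
    and comm: "\<delta> * \<tau> = \<tau> * \<delta>"
    and sq: "\<And>k. k < m \<Longrightarrow> (A * A) $$ (i, k) = e * \<tau> * A $$ (i, k) - e\<^sup>2 * \<delta> * 1\<^sub>m m $$ (i, k)"
  shows "(A ^\<^sub>m Suc n) $$ (i, j) =
    e ^ n * f_poly (int n) \<tau> \<delta> * A $$ (i, j) - e ^ Suc n * \<delta> * f_poly (int n - 1) \<tau> \<delta> * 1\<^sub>m m $$ (i, j)"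
proof -
  have prod: "(B * C) $$ (i, j) = (\<Sum>k = 0..<m. B $$ (i, k) * C $$ (k, j))"
    if "B \<in> carrier_mat m m" "C \<in> carrier_mat m m" for B C :: "'r mat"
    using that i j by (auto simp: scalar_prod_def)
  have pow_Suc_left: "A ^\<^sub>m Suc n = A * A ^\<^sub>m n" for n
  proof (induction n)
    case (Suc n)
    then show ?case using A by (simp add: assoc_mult_mat[of A m m _ m A m])
  qed (use A in simp)
  have "(A ^\<^sub>m Suc (Suc n)) $$ (i, j) = e * \<tau> * (A ^\<^sub>m Suc n) $$ (i, j) - e\<^sup>2 * \<delta> * (A ^\<^sub>m n) $$ (i, j)" for n
  proof -
    let ?P = "A ^\<^sub>m n"
    have P: "?P \<in> carrier_mat m m" using A by simp
    have "A ^\<^sub>m Suc (Suc n) = (A * A) * ?P"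
      by (simp only: pow_Suc_left assoc_mult_mat[OF A A P])
    then have "(A ^\<^sub>m Suc (Suc n)) $$ (i, j) = (\<Sum>k = 0..<m. (A * A) $$ (i, k) * ?P $$ (k, j))"
      using A P by (simp only: prod mult_carrier_mat)
    also have "\<dots> = (\<Sum>k = 0..<m. e * \<tau> * (A $$ (i, k) * ?P $$ (k, j)) - e\<^sup>2 * \<delta> * (1\<^sub>m m $$ (i, k) * ?P $$ (k, j)))"
      by (rule sum.cong) (simp_all only: sq atLeastLessThan_iff left_diff_distrib mult.assoc)
    also have "\<dots> = e * \<tau> * (A * ?P) $$ (i, j) - e\<^sup>2 * \<delta> * (1\<^sub>m m * ?P) $$ (i, j)"
      unfolding prod[OF A P] prod[OF one_carrier_mat P]
      by (simp only: sum_subtractf sum_distrib_left)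
    finally show ?thesis by (simp add: pow_Suc_left left_mult_one_mat[OF P] del: pow_mat.simps)
  qed
  from recurrence_solution_left[where x = "\<lambda>n. (A ^\<^sub>m n) $$ (i, j)", OF central comm this, of n]
  show ?thesis using A by simp
qed


section \<open>Quantum matrices\<close>

locale quantum_2x2 =
  fixes s t a b c d :: "'r::ring_1"
  assumes s_central: "s * x = x * s"
    and s_t: "s * t = 1"
    and t_s: "t * s = 1"
    and ab: "a * b = s * s * b * a"
    and ac: "a * c = s * s * c * a"
    and ad: "a * d - d * a = (s * s - t * t) * b * c"
    and bc: "b * c = c * b"
    and bd: "b * d = s * s * d * b"
    and cd: "c * d = s * s * d * c"
begin

lemma t_central: "t * x = x * t"
  by (metis mult.assoc mult_1_left mult_1_right s_central s_t)

definition \<delta> :: 'r where "\<delta> = a * d - s\<^sup>2 * b * c"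
definition \<tau> :: 'r where "\<tau> = s * a + t * d"
definition \<tau>' :: 'r where "\<tau>' = t * a + s * d"

lemmas a_s = s_central[of a, symmetric] and b_s = s_central[of b, symmetric]
  and c_s = s_central[of c, symmetric] and d_s = s_central[of d, symmetric]
  and a_t = t_central[of a, symmetric] and b_t = t_central[of b, symmetric]
  and c_t = t_central[of c, symmetric] and d_t = t_central[of d, symmetric]

lemma a_d: "a * d = d * a + s * s * b * c - t * t * b * c"
  using ad by (simp add: algebra_simps)

text \<open>Read from left to right, the relations move \<open>s, t\<close> to the front and arrange the generators in
  the order \<open>d, b, c, a\<close>. Together with their versions under a further right factor they rewrite every
  word to a normal form, so that identities between the entries can be checked by expansion.\<close>

lemmas swaps = a_s b_s c_s d_s a_t b_t c_t d_t ab ac a_d bc[symmetric] bd cd s_t t_s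

lemma mult_eq_left: "x * (y * z) = u * z" if "x * y = u" for x y z u :: 'r
  using that by (simp add: mult.assoc[symmetric])

lemmas normal_order = swaps swaps[THEN mult_eq_left]

text \<open>The quantum determinant \<open>\<delta>\<close> commutes with \<open>a\<close> and with \<open>d\<close>: since \<open>a b c = q\<^sup>2 b c a\<close> and
  \<open>b c d = q\<^sup>2 d b c\<close>, the terms from \<open>a d - d a\<close> cancel those from moving \<open>q b c\<close> past \<open>a\<close> or \<open>d\<close>.\<close>

lemma \<delta>_commutes: "\<delta> * \<tau> = \<tau> * \<delta>" "\<delta> * \<tau>' = \<tau>' * \<delta>"
  unfolding \<delta>_def \<tau>_def \<tau>'_def power2_eq_square
  by (simp_all add: ring_distribs mult.assoc normal_order)

text \<open>Entrywise form of \<open>A\<^sup>2 = A E \<tau> - E\<^sup>2 \<delta>\<close>: right multiplication by \<open>E\<close> scales the columns by \<open>t\<close> and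
  \<open>s\<close>, so the factor in front depends on the column.\<close>

lemma square_entries_right:
  "a * a + b * c = t * a * \<tau> - t\<^sup>2 * \<delta>"
  "a * b + b * d = s * b * \<tau>"
  "c * a + d * c = t * c * \<tau>"
  "c * b + d * d = s * d * \<tau> - s\<^sup>2 * \<delta>"
  unfolding \<delta>_def \<tau>_def power2_eq_square
  by (simp_all add: ring_distribs mult.assoc normal_order)

text \<open>Entrywise form of \<open>A\<^sup>2 = \<tau>' E\<inverse> A - E\<inverse>\<^sup>2 \<delta>\<close>: left multiplication by \<open>E\<inverse>\<close> scales the rows by \<open>s\<close> and
  \<open>t\<close>, so the factor in front depends on the row.\<close>

lemma square_entries_left:
  "a * a + b * c = s * \<tau>' * a - s\<^sup>2 * \<delta>"
  "a * b + b * d = s * \<tau>' * b"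
  "c * a + d * c = t * \<tau>' * c"
  "c * b + d * d = t * \<tau>' * d - t\<^sup>2 * \<delta>"
  unfolding \<delta>_def \<tau>'_def power2_eq_square
  by (simp_all add: ring_distribs mult.assoc normal_order)

end

theorem corollary1p2:
  fixes scale :: "'k::field \<Rightarrow> 'r::ring_1 \<Rightarrow> 'r"
    and s t a b c d \<delta> \<tau> \<tau>' :: 'r
    and A :: "'r mat"
    and n :: nat
  assumes "q_algebra scale s t"
    and "A = mat_of_rows_list 2 [[a, b], [c, d]]"
    and "quantum_matrix (s\<^sup>2) (t\<^sup>2) A"
    and "\<delta> = a * d - s\<^sup>2 * b * c"
    and "\<tau> = s * a + t * d"
    and "\<tau>' = t * a + s * d"
    and "n > 0"
  shows
    "(A ^\<^sub>m n) $$ (0,0) = t ^ (n - 1) * a * f_poly (int n - 1) \<tau> \<delta> - t ^ n * \<delta> * f_poly (int n - 2) \<tau> \<delta> \<and>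
     (A ^\<^sub>m n) $$ (0,0) = s ^ (n - 1) * f_poly (int n - 1) \<tau>' \<delta> * a - s ^ n * \<delta> * f_poly (int n - 2) \<tau>' \<delta> \<and>
     (A ^\<^sub>m n) $$ (0,1) = s ^ (n - 1) * b * f_poly (int n - 1) \<tau> \<delta> \<and>
     (A ^\<^sub>m n) $$ (0,1) = s ^ (n - 1) * f_poly (int n - 1) \<tau>' \<delta> * b \<and>
     (A ^\<^sub>m n) $$ (1,0) = t ^ (n - 1) * c * f_poly (int n - 1) \<tau> \<delta> \<and>
     (A ^\<^sub>m n) $$ (1,0) = t ^ (n - 1) * f_poly (int n - 1) \<tau>' \<delta> * c \<and>
     (A ^\<^sub>m n) $$ (1,1) = s ^ (n - 1) * d * f_poly (int n - 1) \<tau> \<delta> - s ^ n * \<delta> * f_poly (int n - 2) \<tau> \<delta> \<and>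
     (A ^\<^sub>m n) $$ (1,1) = t ^ (n - 1) * f_poly (int n - 1) \<tau>' \<delta> * d - t ^ n * \<delta> * f_poly (int n - 2) \<tau>' \<delta>"
proof -
  interpret q_algebra scale s t by fact
  note A = \<open>A = _\<close>
  have entries: "A $$ (0,0) = a" "A $$ (0,1) = b" "A $$ (1,0) = c" "A $$ (1,1) = d"
    unfolding A by (fact mat_of_rows_list_2_entries)+
  have carrier: "A \<in> carrier_mat 2 2"
    using assms(3) by (simp add: quantum_matrix_def)
  interpret Q: quantum_2x2 s t a b c d
    using assms(3) s_t t_s s_central unfolding quantum_matrix_def Let_def entries power2_eq_square
    by unfold_locales blast+
  have defs: "\<delta> = Q.\<delta>" "\<tau> = Q.\<tau>" "\<tau>' = Q.\<tau>'"
    by (simp_all only: assms(4-6) Q.\<delta>_def Q.\<tau>_def Q.\<tau>'_def)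
  have square: "(A * A) $$ (i, j) = A $$ (i, 0) * A $$ (0, j) + A $$ (i, 1) * A $$ (1, j)"
    if "i < 2" "j < 2" for i j
    using carrier that by (simp add: scalar_prod_def numeral_2_eq_2)
  have less_2: "k = 0 \<or> k = 1" if "k < 2" for k :: nat
    using that by auto
  obtain m where n: "n = Suc m"
    using \<open>n > 0\<close> gr0_conv_Suc by auto
  have index: "int n - 1 = int m" "int n - 2 = int m - 1" "n - 1 = m"
    by (simp_all add: n)
  note power_right = index_pow_mat_right[OF carrier _ _ _ Q.\<delta>_commutes(1), where n = m, folded n]
    and power_left = index_pow_mat_left[OF carrier _ _ _ Q.\<delta>_commutes(2), where n = m, folded n]
  have col_0: "(A * A) $$ (k, 0) = t * A $$ (k, 0) * Q.\<tau> - t\<^sup>2 * 1\<^sub>m 2 $$ (k, 0) * Q.\<delta>" if "k < 2" for k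
    using less_2[OF that] square[of k 0] Q.square_entries_right by (auto simp: entries entries[unfolded One_nat_def])
  have col_1: "(A * A) $$ (k, 1) = s * A $$ (k, 1) * Q.\<tau> - s\<^sup>2 * 1\<^sub>m 2 $$ (k, 1) * Q.\<delta>" if "k < 2" for k
    using less_2[OF that] square[of k 1] Q.square_entries_right by (auto simp: entries entries[unfolded One_nat_def])
  have row_0: "(A * A) $$ (0, k) = s * Q.\<tau>' * A $$ (0, k) - s\<^sup>2 * Q.\<delta> * 1\<^sub>m 2 $$ (0, k)" if "k < 2" for k
    using less_2[OF that] square[of 0 k] Q.square_entries_left by (auto simp: entries entries[unfolded One_nat_def])
  have row_1: "(A * A) $$ (1, k) = t * Q.\<tau>' * A $$ (1, k) - t\<^sup>2 * Q.\<delta> * 1\<^sub>m 2 $$ (1, k)" if "k < 2" for k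
    using less_2[OF that] square[of 1 k] Q.square_entries_left by (auto simp: entries entries[unfolded One_nat_def])
  show ?thesis
    unfolding defs index
    using power_right[OF _ _ Q.t_central col_0, of 0] power_right[OF _ _ Q.t_central col_0, of 1]
      power_right[OF _ _ s_central col_1, of 0] power_right[OF _ _ s_central col_1, of 1]
      power_left[OF _ _ s_central row_0, of 0] power_left[OF _ _ s_central row_0, of 1]
      power_left[OF _ _ Q.t_central row_1, of 0] power_left[OF _ _ Q.t_central row_1, of 1]
    by (simp add: entries entries[unfolded One_nat_def])
qed

end
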